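(* Let $R$ be a ring. Then the following are equivalent: (1) $R$ is Zhou nil-clean. (2) $a^5-5a^3+4a$ is nilpotent for all $a\in R$. (3) For any $a\in R$, there exists $e\in \mathbb{Z}[a]$ such that $a-e\in R$ is nilpotent and $e^5=5e^3-4e$.
   Context: All rings are associative with an identity, not necessarily commutative. An element $t$ of a ring is tripotent if $t^3=t$. A ring $R$ is Zhou nil-clean if every element of $R$ is the sum of two tripotents and a nilpotent that (pairwise) commute. For $a\in R$, $\mathbb{Z}[a]=\{f(a) : f(t)\text{ is a polynomial with integral coefficients}\}\subseteq R$. *)

theory Defs
  imports "HOL-Algebra.Ring" "HOL-Computational_Algebra.Polynomial"
begin

text \<open>
  Rings are those of the locale \<open>ring\<close>: associative and unital, not
  necessarily commutative, and the zero ring is allowed (unlike in the class \<open>ring_1\<close>).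
\<close>

definition tripotent :: "('a, 'm) ring_scheme \<Rightarrow> 'a \<Rightarrow> bool" where
  "tripotent R t \<longleftrightarrow> t \<in> carrier R \<and> t [^]\<^bsub>R\<^esub> (3::nat) = t"

definition nilpotent :: "('a, 'm) ring_scheme \<Rightarrow> 'a \<Rightarrow> bool" where
  "nilpotent R x \<longleftrightarrow> x \<in> carrier R \<and> (\<exists>n::nat. n > 0 \<and> x [^]\<^bsub>R\<^esub> n = \<zero>\<^bsub>R\<^esub>)"

definition zhou_nil_clean :: "('a, 'm) ring_scheme \<Rightarrow> bool" where
  "zhou_nil_clean R \<longleftrightarrow>
     (\<forall>a \<in> carrier R. \<exists>s t w.
        tripotent R s \<and> tripotent R t \<and> nilpotent R w \<and>
        s \<otimes>\<^bsub>R\<^esub> t = t \<otimes>\<^bsub>R\<^esub> s \<and>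
        s \<otimes>\<^bsub>R\<^esub> w = w \<otimes>\<^bsub>R\<^esub> s \<and>
        t \<otimes>\<^bsub>R\<^esub> w = w \<otimes>\<^bsub>R\<^esub> t \<and>
        a = s \<oplus>\<^bsub>R\<^esub> t \<oplus>\<^bsub>R\<^esub> w)"

text \<open>
  Value \<open>f(a)\<close> of an integral polynomial. The library's \<open>poly\<close> evaluates only
  in the coefficient ring. The integer coefficients act on \<open>R\<close> by integer
  multiples; the constant term is \<open>[coeff f 0] \<cdot>\<^bsub>R\<^esub> \<one>\<^bsub>R\<^esub>\<close>.
\<close>

definition int_poly_eval :: "('a, 'm) ring_scheme \<Rightarrow> int poly \<Rightarrow> 'a \<Rightarrow> 'a" where
  "int_poly_eval R f a = (\<Oplus>\<^bsub>R\<^esub>i\<in>{..degree f}. [coeff f i] \<cdot>\<^bsub>R\<^esub> (a [^]\<^bsub>R\<^esub> i))"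

definition int_polys_at :: "('a, 'm) ring_scheme \<Rightarrow> 'a \<Rightarrow> 'a set" where
  "int_polys_at R a = {int_poly_eval R f a | f. True}"

end

theory Submission
  imports Defs
begin

text \<open>
  Write \<open>p(t) = t\<^sup>5 - 5 t\<^sup>3 + 4 t = t (t - 1) (t + 1) (t - 2) (t + 2)\<close>. Its roots are exactly the
  numbers \<open>i + j\<close> with \<open>i, j \<in> {-1, 0, 1}\<close>, that is, the possible sums of two eigenvalues of commuting
  tripotents. Hence \<open>p(s + t)\<close> lies in the ideal generated by \<open>s\<^sup>3 - s\<close> and \<open>t\<^sup>3 - t\<close>, and a commuting
  nilpotent summand changes \<open>p\<close> only by a nilpotent. This is (1) to (2); the same perturbation argument
  gives (3) to (2).

  For the converse directions, (2) at \<open>a = 3\<close> says that \<open>p(3) = 120\<close> is nilpotent, so some power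
  of \<open>30\<close> vanishes and the ring splits into three parts in which \<open>2\<close>, \<open>3\<close> and \<open>5\<close>, respectively,
  is nilpotent. The splitting is by integers, \<open>1 = u\<^sub>2 + u\<^sub>3 + u\<^sub>5\<close>, so it is visible in \<open>\<int>[a]\<close>. Modulo
  nilpotents \<open>a\<close> is a root of \<open>t\<^sup>2 - t\<close>, of \<open>t\<^sup>3 - t\<close> and of \<open>p\<close> in the three parts, because \<open>p\<close> has the same
  irreducible factors as these polynomials modulo \<open>2\<close>, \<open>3\<close> and \<open>5\<close>. The polynomial \<open>p\<close> itself is not
  separable modulo \<open>2\<close> or \<open>3\<close>, but
  \<open>q = u\<^sub>2 (t\<^sup>2 - t) + u\<^sub>3 (t\<^sup>3 - t) + u\<^sub>5 p\<close> has derivative \<open>-1\<close> modulo nilpotents at every point.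
  So \<open>a\<close> lifts to an exact root \<open>e \<in> \<int>[a]\<close> of \<open>q\<close> by Hensel's lemma (\<open>hensel_lifting\<close>), and \<open>p(e) = 0\<close>
  follows part by part, since \<open>t\<^sup>2 - t\<close> and \<open>t\<^sup>3 - t\<close> divide \<open>p\<close>. This is (3). For (1), Lagrange interpolation
  writes the eigenvalues \<open>-2, -1, 0, 1, 2\<close> as sums of two elements of \<open>{-1, 0, 1}\<close>: the second summand is
  \<open>(e\<^sup>3 - e)/6\<close>. It makes sense where \<open>5\<close> is nilpotent, as \<open>6\<close> is a unit there. In the other two parts \<open>e\<^sup>3 = e\<close>, so
  any integer may replace \<open>1/6\<close>: the second summand is \<open>0\<close> and \<open>e\<close> is itself tripotent (\<open>separating_root\<close>).

  All this is commutative algebra modulo an ideal. It is carried out in polynomial rings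
  over \<open>\<int>\<close>, which map to \<open>R\<close> as soon as the images of the variables commute (\<open>type_ring_hom_extend_hom\<close>);
  the ideal is the kernel of that map, and its radical consists of the polynomials with nilpotent value
  (\<open>radical_kernel_iff\<close>).
\<close>

section \<open>The quintic\<close>

definition quintic :: "'b::comm_ring_1 \<Rightarrow> 'b" where
  "quintic x = x ^ 5 - 5 * x ^ 3 + 4 * x"

text \<open>
  The cofactors come from expanding \<open>p(s + t)\<close> and reducing \<open>s\<^sup>3\<close> to \<open>s\<close> and \<open>t\<^sup>3\<close> to \<open>t\<close>.
\<close>
lemma quintic_sum_cofactors:
  fixes s t :: "'b::comm_ring_1"
  shows "quintic (s + t) =
    (s^2 + 5*s*t + 10*t^2 - 4) * (s ^ 3 - s) + (10*s^2 + 5*s*t + t^2 - 4) * (t ^ 3 - t)"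
  unfolding quintic_def by (simp add: algebra_simps eval_nat_numeral)

section \<open>Ideals and their radicals\<close>

locale comm_ring_ideal =
  fixes I :: "'b::comm_ring_1 set"
  assumes zero_mem: "0 \<in> I"
    and add_mem: "x \<in> I \<Longrightarrow> y \<in> I \<Longrightarrow> x + y \<in> I"
    and mult_mem: "x \<in> I \<Longrightarrow> a * x \<in> I"
begin

lemma mult_mem_right: "x \<in> I \<Longrightarrow> x * a \<in> I"
  using mult_mem[of x a] by (simp add: mult.commute)

lemma uminus_mem: "x \<in> I \<Longrightarrow> - x \<in> I"
  using mult_mem[of x "-1"] by simp

lemma diff_mem: "x \<in> I \<Longrightarrow> y \<in> I \<Longrightarrow> x - y \<in> I"
  using add_mem[of x "- y"] uminus_mem by simp

lemma sum_mem: "(\<And>i. i \<in> S \<Longrightarrow> f i \<in> I) \<Longrightarrow> sum f S \<in> I"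
  by (induction S rule: infinite_finite_induct) (simp_all add: zero_mem add_mem)

lemma diff_swap_mem: "x - y \<in> I \<Longrightarrow> y - x \<in> I"
  using uminus_mem[of "x - y"] by simp

lemma power_mem_mono: "x ^ m \<in> I \<Longrightarrow> m \<le> n \<Longrightarrow> x ^ n \<in> I"
  using mult_mem[of "x ^ m" "x ^ (n - m)"] by (simp flip: power_add)

lemma power_diff_mem:
  assumes "a - b \<in> I"
  shows "a ^ m - b ^ m \<in> I"
proof (induction m)
  case (Suc m)
  have "a ^ Suc m - b ^ Suc m = a * (a ^ m - b ^ m) + b ^ m * (a - b)"
    by (simp add: algebra_simps)
  then show ?case using Suc assms by (simp add: add_mem mult_mem)
qed (simp add: zero_mem)

definition radical :: "'b set" where
  "radical = {x. \<exists>n. x ^ n \<in> I}"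

lemma radicalI: "x ^ n \<in> I \<Longrightarrow> x \<in> radical"
  by (auto simp: radical_def)

lemma mem_radical: "x \<in> I \<Longrightarrow> x \<in> radical"
  by (rule radicalI[of _ 1]) simp

lemma power_mem_radicalD: "x ^ n \<in> radical \<Longrightarrow> x \<in> radical"
  by (auto simp: radical_def simp flip: power_mult)

lemma comm_ring_ideal_radical: "comm_ring_ideal radical"
proof
  show "0 \<in> radical" by (simp add: mem_radical zero_mem)
next
  fix x y assume "x \<in> radical" "y \<in> radical"
  then obtain m n where mn: "x ^ m \<in> I" "y ^ n \<in> I" by (auto simp: radical_def)
  \<comment> \<open>In degree \<open>m + n\<close> every binomial term contains \<open>x\<^sup>m\<close> or \<open>y\<^sup>n\<close>.\<close>
  have "of_nat ((m + n) choose k) * x ^ k * y ^ (m + n - k) \<in> I" for k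
  proof (cases "m \<le> k")
    case True
    then have "x ^ k \<in> I" using mn(1) power_mem_mono by blast
    then show ?thesis using mult_mem mult_mem_right by blast
  next
    case False
    then have "y ^ (m + n - k) \<in> I" by (intro power_mem_mono[OF mn(2)]) auto
    then show ?thesis by (rule mult_mem)
  qed
  then have "(x + y) ^ (m + n) \<in> I" by (simp only: binomial_ring sum_mem)
  then show "x + y \<in> radical" by (rule radicalI)
next
  fix x a assume "x \<in> radical"
  then obtain m where "x ^ m \<in> I" by (auto simp: radical_def)
  then have "(a * x) ^ m \<in> I" by (simp add: power_mult_distrib mult_mem)
  then show "a * x \<in> radical" by (rule radicalI)
qed

interpretation rad: comm_ring_ideal radical by (rule comm_ring_ideal_radical)

text \<open>Geometric series: \<open>d v = 1 - r\<close> with \<open>r\<close> nilpotent.\<close>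
lemma inverse_mod_radical_lifts:
  assumes "d * v - 1 \<in> radical"
  shows "\<exists>v'. d * v' - 1 \<in> I"
proof -
  define r where "r = 1 - d * v"
  have "r \<in> radical" using rad.diff_swap_mem[OF assms] by (simp add: r_def)
  then obtain N where N: "r ^ N \<in> I" by (auto simp: radical_def)
  have "d * (v * (\<Sum>i<N. r ^ i)) - 1 = (1 - r) * (\<Sum>i<N. r ^ i) - 1"
    by (simp add: r_def algebra_simps)
  also have "\<dots> = - (r ^ N)" by (simp flip: one_diff_power_eq)
  finally show ?thesis using uminus_mem[OF N] by metis
qed

lemma quintic_diff_mem:
  assumes "x - y \<in> I"
  shows "quintic x - quintic y \<in> I"
proof -
  have "quintic x - quintic y = (x ^ 5 - y ^ 5) - 5 * (x ^ 3 - y ^ 3) + 4 * (x - y)"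
    by (simp add: quintic_def algebra_simps)
  then show ?thesis
    using power_diff_mem[OF assms] assms by (simp only: add_mem diff_mem mult_mem)
qed

lemma quintic_radical_of_root:
  assumes "quintic e \<in> I" "x - e \<in> radical"
  shows "quintic x \<in> radical"
proof -
  have "quintic x - quintic e \<in> radical"
    using comm_ring_ideal_radical assms(2) by (rule comm_ring_ideal.quintic_diff_mem)
  from rad.add_mem[OF this mem_radical[OF assms(1)]] show ?thesis by simp
qed

lemma quintic_root_of_tripotents:
  assumes "s ^ 3 - s \<in> I" "t ^ 3 - t \<in> I"
  shows "quintic (s + t) \<in> I"
  unfolding quintic_sum_cofactors by (intro add_mem mult_mem assms)

lemma thirty_mem_radical:
  assumes "quintic 3 \<in> radical"
  shows "30 \<in> radical"
proof (rule power_mem_radicalD)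
  have "(30::'b) ^ 3 = 225 * quintic 3" by (simp add: quintic_def)
  then show "(30::'b) ^ 3 \<in> radical" using assms by (simp only: rad.mult_mem)
qed

text \<open>
  The Chinese remainder theorem for \<open>2\<^sup>k 3\<^sup>k 5\<^sup>k \<in> I\<close>: the \<open>u\<^sub>i\<close> are orthogonal idempotents modulo \<open>I\<close>, and
  on the component of \<open>u\<^sub>i\<close> the prime \<open>i\<close> is nilpotent. On the last component \<open>6 = 1 + 5\<close> is
  therefore a unit; \<open>c\<close> is its inverse there.
\<close>
lemma splitting_235:
  assumes "30 \<in> radical"
  obtains u2 u3 u5 c where "u2 + u3 + u5 = 1"
    "u2 * u3 \<in> I" "u2 * u5 \<in> I" "u3 * u5 \<in> I"
    "2 * u2 \<in> radical" "3 * u3 \<in> radical" "5 * u5 \<in> radical"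
    "u5 * (6 * c - 1) \<in> I"
proof -
  obtain k' where "30 ^ k' \<in> I" using assms by (auto simp: radical_def)
  \<comment> \<open>A positive exponent makes \<open>2 u\<^sub>2\<close>, \<open>3 u\<^sub>3\<close>, \<open>5 u\<^sub>5\<close> divisible by \<open>30\<close> below.\<close>
  then obtain k where k: "30 ^ k \<in> I" "k > 0"
    using power_mem_mono[of 30 k' "Suc k'"] by (metis le_SucI order_refl zero_less_Suc)
  have mem: "of_int z \<in> I" if "30 ^ k dvd z" for z :: int
    using that mult_mem_right[OF k(1)] by (auto elim!: dvdE)
  have rad: "of_int z \<in> radical" if "30 ^ k dvd z ^ k" for z :: int
    using mem[OF that] radicalI[of "of_int z" k] by simp
  have "coprime (6 ^ k) (5 ^ k :: int)" "coprime (3 ^ k) (2 ^ k :: int)"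
    using coprime_add_one_left[of "5::int"] coprime_add_one_left[of "2::int"] by simp_all
  then obtain a b a' b' :: int
    where ab: "a * 6 ^ k + b * 5 ^ k = 1" "a' * 3 ^ k + b' * 2 ^ k = 1"
    using bezout_int[of "6 ^ k" "5 ^ k"] bezout_int[of "3 ^ k" "2 ^ k"]
    by (auto simp: coprime_iff_gcd_eq_1)
  \<comment> \<open>The two relations combine to one between \<open>15\<^sup>k\<close>, \<open>10\<^sup>k\<close> and \<open>6\<^sup>k\<close>.\<close>
  define v2 v3 v5 where v: "v2 = a' * b * 15 ^ k" "v3 = b' * b * 10 ^ k" "v5 = a * 6 ^ k"
  \<comment> \<open>The truncated geometric series for \<open>1 / (1 + 5)\<close>.\<close>
  define c where "c = (\<Sum>i<k. (- 5) ^ i :: int)"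
  have p: "(15::int) ^ k = 3 ^ k * 5 ^ k" "(10::int) ^ k = 2 ^ k * 5 ^ k"
    "(6::int) ^ k = 2 ^ k * 3 ^ k" "(30::int) ^ k = 2 ^ k * 3 ^ k * 5 ^ k"
    by (simp_all flip: power_mult_distrib)
  have "v2 + v3 + v5 = (a' * 3 ^ k + b' * 2 ^ k) * (b * 5 ^ k) + a * 6 ^ k"
    unfolding v p by (simp add: algebra_simps)
  then have sum: "v2 + v3 + v5 = 1" using ab by simp
  have c: "6 * c - 1 = - ((- 5) ^ k)"
    using one_diff_power_eq[of "- 5 :: int" k] unfolding c_def by simp
  have "30 ^ k dvd v2 * v3" "30 ^ k dvd v2 * v5" "30 ^ k dvd v3 * v5"
    unfolding v p by (auto intro: mult_dvd_mono simp: dvd_def algebra_simps)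
  note dvd = this
  have "v5 * (6 * c - 1) = 30 ^ k * (- a * (- 1) ^ k)"
    unfolding v c p power_minus[of 5] by simp
  then have dvd5: "30 ^ k dvd v5 * (6 * c - 1)" by simp
  have "15 dvd v2" "10 dvd v3" "6 dvd v5"
    unfolding v using k(2) by (simp_all add: dvd_power dvd_mult)
  then have "30 dvd 2 * v2" "30 dvd 3 * v3" "30 dvd 5 * v5" by presburger+
  note dvd_pow = this[THEN dvd_power_same, of k]
  show thesis
  proof (rule that)
    show "of_int v2 + of_int v3 + of_int v5 = (1::'b)"
      using sum by (simp flip: of_int_add)
    show "of_int v5 * (6 * of_int c - 1) \<in> I"
      using mem[OF dvd5] by simp
  qed (use dvd[THEN mem] dvd_pow[THEN rad] in simp_all)
qed

end

text \<open>
  For orthogonal \<open>u\<close>, \<open>v\<close>, \<open>w\<close> with sum \<open>1\<close> this recovers the \<open>u\<close>-component of \<open>u a + v b + w c\<close>; the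
  remaining terms are the errors when orthogonality holds only modulo an ideal.
\<close>
lemma orthogonal_component:
  fixes u v w :: "'b::comm_ring_1"
  assumes "u + v + w = 1"
  shows "u * a = u * (u * a + v * b + w * c) + (u * v) * (a - b) + (u * w) * (a - c)"
proof -
  have "u * (u * a + v * b + w * c) + (u * v) * (a - b) + (u * w) * (a - c) = (u + v + w) * (u * a)"
    by (simp add: algebra_simps)
  then show ?thesis using assms by simp
qed

section \<open>Hensel lifting and the separating root\<close>

lemma taylor2:
  fixes q :: "'b::idom poly"
  shows "\<exists>c. poly q (y + h) = poly q y + h * poly (pderiv q) y + h ^ 2 * c"
proof (induction q)
  case 0
  show ?case by (intro exI[of _ 0]) simp
next
  case (pCons a q)
  then obtain c where c: "poly q (y + h) = poly q y + h * poly (pderiv q) y + h ^ 2 * c" by blast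
  have "poly (pCons a q) (y + h) = poly (pCons a q) y + h * poly (pderiv (pCons a q)) y
      + h ^ 2 * (poly (pderiv q) y + (y + h) * c)"
    unfolding pderiv_pCons poly_pCons poly_add poly_0 add_0_left c
    by (simp add: algebra_simps eval_nat_numeral)
  then show ?case by blast
qed

text \<open>Integral domains are the setting of \<open>pderiv\<close>, and polynomial rings over \<open>\<int>\<close> are among them.\<close>
locale idom_ideal = comm_ring_ideal I for I :: "'b::idom set"
begin

interpretation rad: comm_ring_ideal radical by (rule comm_ring_ideal_radical)

text \<open>
  Newton iteration: one step multiplies the order of vanishing of \<open>q\<close> by two, up to \<open>I\<close>, and the
  derivative stays a unit because the point moves only within the radical. The inverse \<open>v\<close> of the derivative
  is required only modulo the radical; it is improved to an inverse modulo \<open>I\<close> at each step.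
\<close>
lemma hensel_lifting:
  assumes "poly q x \<in> radical" and "poly (pderiv q) x * v - 1 \<in> radical"
  shows "\<exists>e. poly q e \<in> I \<and> e - x \<in> radical"
proof -
  have "\<exists>e. poly q e \<in> I \<and> e - y \<in> radical"
    if "poly q y ^ n \<in> I" "poly (pderiv q) y * v - 1 \<in> radical" for n y
    using that
  proof (induction n arbitrary: y rule: less_induct)
    case (less n)
    show ?case
    proof (cases "n \<le> 1")
      case True
      then have "poly q y \<in> I" using less.prems(1) power_mem_mono[of "poly q y" n 1] by simp
      then show ?thesis by (intro exI[of _ y]) (simp add: rad.zero_mem)
    next
      case False
      obtain v' where v': "poly (pderiv q) y * v' - 1 \<in> I"
        using inverse_mod_radical_lifts less.prems(2) by blast
      define h where "h = - poly q y * v'"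
      have h_rad: "h \<in> radical"
        unfolding h_def using less.prems(1) radicalI by (intro rad.mult_mem_right rad.uminus_mem) blast
      obtain c where c: "poly q (y + h) = poly q y + h * poly (pderiv q) y + h ^ 2 * c"
        using taylor2 by blast
      \<comment> \<open>The linear term cancels modulo \<open>I\<close>, by the choice of \<open>h\<close>.\<close>
      have "poly q (y + h) - poly q y ^ 2 * (v' ^ 2 * c)
          = (- poly q y) * (poly (pderiv q) y * v' - 1)"
        unfolding c unfolding h_def by (simp add: algebra_simps power2_eq_square)
      then have "poly q (y + h) - poly q y ^ 2 * (v' ^ 2 * c) \<in> I"
        using v' by (simp only: mult_mem)
      then have "poly q (y + h) ^ (n - 1) - (poly q y ^ 2 * (v' ^ 2 * c)) ^ (n - 1) \<in> I"
        by (rule power_diff_mem)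
      \<comment> \<open>For \<open>n \<ge> 2\<close> the halved order of nilpotency is at most \<open>n - 1\<close>, which is all that the induction needs.\<close>
      moreover have "poly q y ^ (2 * (n - 1)) \<in> I"
        using False by (intro power_mem_mono[OF less.prems(1)]) auto
      then have "(poly q y ^ 2 * (v' ^ 2 * c)) ^ (n - 1) \<in> I"
        unfolding power_mult_distrib power_mult[symmetric] by (intro mult_mem_right)
      ultimately have "poly q (y + h) ^ (n - 1) \<in> I"
        using add_mem by fastforce
      moreover have "poly (pderiv q) (y + h) * v - 1 \<in> radical"
      proof -
        obtain c' where c': "poly (pderiv q) (y + h)
            = poly (pderiv q) y + h * poly (pderiv (pderiv q)) y + h ^ 2 * c'"
          using taylor2 by blast
        have "poly (pderiv q) (y + h) * v - 1 = (poly (pderiv q) y * v - 1)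
            + h * ((poly (pderiv (pderiv q)) y + h * c') * v)"
          unfolding c' by (simp add: algebra_simps power2_eq_square)
        then show ?thesis using less.prems(2) h_rad by (simp only: rad.add_mem rad.mult_mem_right)
      qed
      ultimately obtain e where e: "poly q e \<in> I" "e - (y + h) \<in> radical"
        using less.IH[of "n - 1" "y + h"] False by auto
      have "e - y \<in> radical" using rad.add_mem[OF e(2) h_rad] by simp
      with e(1) show ?thesis by blast
    qed
  qed
  moreover obtain n where "poly q x ^ n \<in> I" using assms(1) by (auto simp: radical_def)
  ultimately show ?thesis using assms(2) by blast
qed

text \<open>
  The heart of the proof. Modulo the radical, \<open>x\<close> is a root of \<open>t\<^sup>2 - t\<close> where \<open>2\<close> is nilpotent, of
  \<open>t\<^sup>3 - t\<close> where \<open>3\<close> is, and of the quintic where \<open>5\<close> is. These three polynomials are separable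
  modulo the respective prime, so their combination \<open>q\<close> admits Hensel lifting. The tripotents are \<open>t = c (e\<^sup>3 - e)\<close>,
  with \<open>c\<close> an inverse of \<open>6\<close> on the \<open>5\<close>-component, and \<open>e - t\<close>.
\<close>
lemma separating_root:
  assumes "30 \<in> radical" and "quintic x \<in> radical"
  obtains e t where "quintic e \<in> I" "x - e \<in> radical"
    "t ^ 3 - t \<in> I" "(e - t) ^ 3 - (e - t) \<in> I"
proof -
  obtain u2 u3 u5 c where u: "u2 + u3 + u5 = 1"
    and orth: "u2 * u3 \<in> I" "u2 * u5 \<in> I" "u3 * u5 \<in> I"
    and nil: "2 * u2 \<in> radical" "3 * u3 \<in> radical" "5 * u5 \<in> radical"
    and c: "u5 * (6 * c - 1) \<in> I"
    using splitting_235[OF assms(1)] .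
  define q where "q = smult u2 [:0, -1, 1:] + smult u3 [:0, -1, 0, 1:] + smult u5 [:0, 4, 0, -5, 0, 1:]"
  have q: "poly q y = u2 * (y ^ 2 - y) + u3 * (y ^ 3 - y) + u5 * quintic y" for y
    by (simp add: q_def quintic_def algebra_simps eval_nat_numeral)
  \<comment> \<open>Modulo \<open>2\<close>, \<open>(x\<^sup>2 - x)\<^sup>3 = (x - 1) p(x)\<close>; modulo \<open>3\<close>, \<open>(x\<^sup>3 - x)\<^sup>2 = x p(x)\<close>.\<close>
  have cube: "(u2 * (x ^ 2 - x)) ^ 3 = (u2 ^ 3 * (x - 1)) * quintic x
      + (2 * u2) * (u2 ^ 2 * (x - 1) ^ 2 * x * (- (x ^ 2) + 2 * x + 2))"
    unfolding quintic_def by (simp add: algebra_simps eval_nat_numeral)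
  have 2: "u2 * (x ^ 2 - x) \<in> radical"
    by (rule power_mem_radicalD[of _ 3])
      (simp only: cube rad.add_mem rad.mult_mem rad.mult_mem_right assms nil)
  have square: "(u3 * (x ^ 3 - x)) ^ 2 = (u3 ^ 2 * x) * quintic x
      + (3 * u3) * (u3 * x ^ 2 * (x ^ 2 - 1))"
    unfolding quintic_def by (simp add: algebra_simps eval_nat_numeral)
  have 3: "u3 * (x ^ 3 - x) \<in> radical"
    by (rule power_mem_radicalD[of _ 2])
      (simp only: square rad.add_mem rad.mult_mem rad.mult_mem_right assms nil)
  have "poly q x \<in> radical"
    unfolding q by (intro rad.add_mem rad.mult_mem 2 3 assms)
  \<comment> \<open>Modulo \<open>2\<close>, \<open>3\<close>, \<open>5\<close> the derivatives of the three pieces are all \<open>-1\<close>.\<close>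
  moreover have "poly (pderiv q) x * (- 1) - 1 \<in> radical"
  proof -
    have "poly (pderiv q) x = u2 * (2 * x - 1) + u3 * (3 * x ^ 2 - 1) + u5 * (5 * x ^ 4 - 15 * x ^ 2 + 4)"
      by (simp add: q_def pderiv_add pderiv_smult pderiv_pCons algebra_simps eval_nat_numeral)
    then have "poly (pderiv q) x * (- 1) - (u2 + u3 + u5) = - ((2 * u2) * x + (3 * u3) * x ^ 2
        + (5 * u5) * (x ^ 4 - 3 * x ^ 2 + 1))"
      by (simp add: algebra_simps)
    then show ?thesis
      by (simp only: u rad.uminus_mem rad.add_mem rad.mult_mem_right nil)
  qed
  ultimately obtain e where e: "poly q e \<in> I" "e - x \<in> radical"
    using hensel_lifting by blast
  define F where "F = e ^ 3 - e"
  have component: "u * a \<in> I"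
    if "u + v + w = 1" "u * a + v * b + w * c \<in> I" "u * v \<in> I" "u * w \<in> I" for u v w a b c
    by (subst orthogonal_component[OF that(1), of a b c])
      (intro add_mem mult_mem mult_mem_right that)
  have root2: "u2 * (e ^ 2 - e) \<in> I"
    by (rule component[of u2 u3 u5 _ F "quintic e"])
      (use u orth e(1) in \<open>simp_all add: q F_def\<close>)
  have root3: "u3 * F \<in> I"
    by (rule component[of u3 u2 u5 _ "e ^ 2 - e" "quintic e"])
      (use u orth e(1) in \<open>simp_all add: q F_def ac_simps\<close>)
  have root5: "u5 * quintic e \<in> I"
    by (rule component[of u5 u2 u3 _ "e ^ 2 - e" F])
      (use u orth e(1) in \<open>simp_all add: q F_def ac_simps\<close>)
  have split: "z = (u2 + u3) * z + u5 * z" for z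
    using u by (simp flip: distrib_right)
  have "(u2 + u3) * F = (u2 * (e ^ 2 - e)) * (e + 1) + u3 * F"
    unfolding F_def by (simp add: algebra_simps eval_nat_numeral)
  then have root23: "(u2 + u3) * F \<in> I"
    by (simp only: add_mem mult_mem_right root2 root3)
  have "quintic e = F * (e ^ 2 - 4)"
    unfolding F_def quintic_def by (simp add: algebra_simps eval_nat_numeral)
  then have "quintic e = ((u2 + u3) * F) * (e ^ 2 - 4) + u5 * quintic e"
    using split[of "quintic e"] by (simp add: mult.assoc)
  then have "quintic e \<in> I"
    using add_mem[OF mult_mem_right[OF root23] root5] by metis
  moreover have "x - e \<in> radical" using rad.diff_swap_mem[OF e(2)] .
  moreover have "(c * F) ^ 3 - c * F \<in> I"
  proof -
    have 1: "(c * F) ^ 3 - c * F = F * (c ^ 3 * F ^ 2 - c)"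
      by (simp add: algebra_simps eval_nat_numeral)
    \<comment> \<open>From \<open>F\<^sup>3 - 36 F = p(e) (e\<^sup>2 + 2 e + 3) (e\<^sup>2 - 2 e + 3)\<close>, multiplied by \<open>c\<^sup>3\<close>.\<close>
    have 2: "(c * F) ^ 3 - c * F = quintic e * (c ^ 3 * (e ^ 2 + 2 * e + 3) * (e ^ 2 - 2 * e + 3))
        + (6 * c - 1) * ((6 * c + 1) * (c * F))"
      unfolding F_def quintic_def by (simp add: algebra_simps eval_nat_numeral)
    have "(c * F) ^ 3 - c * F = ((u2 + u3) * F) * (c ^ 3 * F ^ 2 - c)
        + ((u5 * quintic e) * (c ^ 3 * (e ^ 2 + 2 * e + 3) * (e ^ 2 - 2 * e + 3))
        + (u5 * (6 * c - 1)) * ((6 * c + 1) * (c * F)))"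
      by (subst split, subst (2) 2, subst 1) (simp only: distrib_left mult.assoc)
    then show ?thesis by (simp only: add_mem mult_mem_right root23 root5 c)
  qed
  moreover have "(e - c * F) ^ 3 - (e - c * F) \<in> I"
  proof -
    \<comment> \<open>Interpolation gives \<open>(7 e - e\<^sup>3)/6\<close> for the first tripotent; it differs from \<open>e - c F\<close> by a multiple of \<open>6 c - 1\<close>.\<close>
    define r where "r = c * (7 * e - e ^ 3)"
    define d where "d = 6 * c - 1"
    have s: "e - c * F = r - d * e"
      unfolding r_def d_def F_def by (simp add: algebra_simps eval_nat_numeral)
    have 1: "(e - c * F) ^ 3 - (e - c * F)
        = F * (1 + c * (- 3 * e ^ 2 + 3 * e * (c * F) - (c * F) ^ 2 + 1))"
      unfolding F_def by (simp add: algebra_simps eval_nat_numeral)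
    \<comment> \<open>From \<open>g\<^sup>3 - 36 g = p(e) (7 - e\<^sup>2) (e\<^sup>2 - 9)\<close> for \<open>g = 7 e - e\<^sup>3\<close>.\<close>
    have 2: "r ^ 3 - r = c ^ 3 * (quintic e * (7 - e ^ 2) * (e ^ 2 - 9)) + d * ((6 * c + 1) * r)"
      unfolding r_def d_def quintic_def by (simp add: algebra_simps eval_nat_numeral)
    have 3: "(r - d * e) ^ 3 - (r - d * e)
        = (r ^ 3 - r) + d * (- 3 * r ^ 2 * e + 3 * r * d * e ^ 2 - d ^ 2 * e ^ 3 + e)"
      by (simp add: algebra_simps eval_nat_numeral)
    have 4: "(e - c * F) ^ 3 - (e - c * F)
        = quintic e * (c ^ 3 * (7 - e ^ 2) * (e ^ 2 - 9))
        + d * ((6 * c + 1) * r + (- 3 * r ^ 2 * e + 3 * r * d * e ^ 2 - d ^ 2 * e ^ 3 + e))"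
      unfolding s 3 2 by (simp only: distrib_left mult_ac add_ac)
    have "(e - c * F) ^ 3 - (e - c * F)
        = ((u2 + u3) * F) * (1 + c * (- 3 * e ^ 2 + 3 * e * (c * F) - (c * F) ^ 2 + 1))
        + ((u5 * quintic e) * (c ^ 3 * (7 - e ^ 2) * (e ^ 2 - 9))
        + (u5 * d) * ((6 * c + 1) * r + (- 3 * r ^ 2 * e + 3 * r * d * e ^ 2 - d ^ 2 * e ^ 3 + e)))"
      by (subst split, subst (2) 4, subst 1) (simp only: distrib_left mult.assoc)
    then show ?thesis
      by (simp only: add_mem mult_mem_right root23 root5 c[folded d_def])
  qed
  ultimately show thesis by (rule that)
qed

end

section \<open>Homomorphisms from commutative ring types\<close>

lemma (in ring) diff_eq_zero_iff:
  assumes "x \<in> carrier R" "y \<in> carrier R"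
  shows "x \<ominus> y = \<zero> \<longleftrightarrow> x = y"
  using assms minus_equality[of x "\<ominus> y"] by (auto simp: minus_eq r_neg)

text \<open>
  The domain is commutative, hence so is the image; the codomain is any ring. Such maps carry polynomial
  identities into commutative parts of \<open>R\<close>.
\<close>
locale type_ring_hom = ring R for R (structure) +
  fixes h :: "'b::comm_ring_1 \<Rightarrow> 'a"
  assumes hom_closed [simp, intro]: "h x \<in> carrier R"
    and hom_add: "h (x + y) = h x \<oplus> h y"
    and hom_mult: "h (x * y) = h x \<otimes> h y"
    and hom_one: "h 1 = \<one>"
begin

lemma hom_zero: "h 0 = \<zero>"
  using hom_add[of 0 0] by (simp add: add.l_cancel_one')

lemma hom_uminus: "h (- x) = \<ominus> h x"
  using hom_add[of "- x" x] by (simp add: hom_zero minus_equality)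

lemma hom_diff: "h (x - y) = h x \<ominus> h y"
  using hom_add[of x "- y"] by (simp add: hom_uminus minus_eq)

lemma hom_power: "h (x ^ n) = h x [^] n"
  by (induction n) (simp_all add: hom_one hom_mult power_Suc2 del: power_Suc)

lemma hom_of_nat_mult: "h (of_nat n * x) = [n] \<cdot> h x"
  by (induction n) (simp_all add: hom_zero hom_add distrib_right a_comm)

lemma hom_of_int_mult: "h (of_int k * x) = [k] \<cdot> h x"
proof (cases "k \<ge> 0")
  case True
  then show ?thesis using hom_of_nat_mult[of "nat k" x] by (simp add: add_pow_int_ge)
next
  case False
  then show ?thesis
    using hom_of_nat_mult[of "nat (- k)" x] hom_uminus[of "of_int (- k) * x"]
    by (simp add: add_pow_int_lt)
qed

lemma hom_numeral_mult: "h (numeral k * x) = [(numeral k :: int)] \<cdot> h x"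
  using hom_of_int_mult[of "numeral k" x] by simp

lemma hom_quintic: "h (quintic x) = h x [^] (5::nat) \<ominus> [(5::int)] \<cdot> (h x [^] (3::nat)) \<oplus> [(4::int)] \<cdot> h x"
  by (simp add: quintic_def hom_add hom_diff hom_numeral_mult hom_power)

sublocale kernel: comm_ring_ideal "{x. h x = \<zero>}"
  by unfold_locales (simp_all add: hom_zero hom_add hom_mult)

text \<open>Raising the exponent by one covers \<open>x\<^sup>0\<close>, which is in the kernel only if the image ring is zero.\<close>
lemma radical_kernel_iff: "x \<in> kernel.radical \<longleftrightarrow> nilpotent R (h x)"
proof
  assume "x \<in> kernel.radical"
  then obtain n where "x ^ n \<in> {x. h x = \<zero>}" by (auto simp: kernel.radical_def)
  then have "x ^ Suc n \<in> {x. h x = \<zero>}" by (rule kernel.power_mem_mono) simp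
  then show "nilpotent R (h x)"
    unfolding nilpotent_def hom_power mem_Collect_eq by blast
qed (auto simp: nilpotent_def kernel.radical_def hom_power)

lemma kernel_diff_iff: "h (x - y) = \<zero> \<longleftrightarrow> h x = h y"
  by (simp add: hom_diff diff_eq_zero_iff)

end

text \<open>
  The evaluation \<open>\<Sum>i. a\<^sup>i h (coeff f i)\<close> in Horner form, which matches induction over \<open>pCons\<close>.
\<close>
definition extend_hom :: "('a, 'm) ring_scheme \<Rightarrow> ('b::zero \<Rightarrow> 'a) \<Rightarrow> 'a \<Rightarrow> 'b poly \<Rightarrow> 'a" where
  "extend_hom R h a f = fold_coeffs (\<lambda>c y. h c \<oplus>\<^bsub>R\<^esub> a \<otimes>\<^bsub>R\<^esub> y) f \<zero>\<^bsub>R\<^esub>"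

context type_ring_hom
begin

context
  fixes a
  assumes a_closed [simp]: "a \<in> carrier R"
begin

lemma extend_hom_0 [simp]: "extend_hom R h a 0 = \<zero>"
  by (simp add: extend_hom_def)

lemma extend_hom_pCons [simp]:
  "extend_hom R h a (pCons c f) = h c \<oplus> a \<otimes> extend_hom R h a f"
  by (cases "c = 0"; cases "f = 0") (simp_all add: extend_hom_def hom_zero)

lemma extend_hom_closed [simp]: "extend_hom R h a f \<in> carrier R"
  by (induction f) simp_all

lemma extend_hom_const: "extend_hom R h a [:c:] = h c"
  by simp

lemma extend_hom_var: "extend_hom R h a [:0, 1:] = a"
  by (simp add: hom_one hom_zero)

lemma extend_hom_commutes:
  assumes "b \<in> carrier R" "a \<otimes> b = b \<otimes> a" "\<And>x. h x \<otimes> b = b \<otimes> h x"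
  shows "extend_hom R h a f \<otimes> b = b \<otimes> extend_hom R h a f"
proof (induction f)
  case (pCons c f)
  have "a \<otimes> extend_hom R h a f \<otimes> b = a \<otimes> (b \<otimes> extend_hom R h a f)"
    using assms pCons by (simp add: m_assoc)
  also have "\<dots> = b \<otimes> (a \<otimes> extend_hom R h a f)"
    using assms by (simp flip: m_assoc)
  finally show ?case using assms by (simp add: l_distr r_distr)
qed (use assms in simp)

text \<open>
  The universal property of the polynomial ring. Over a noncommutative \<open>R\<close> it holds for a value \<open>a\<close>
  of the variable that commutes with the images of the coefficients.
\<close>
lemma type_ring_hom_extend_hom:
  assumes comm: "\<And>x. h x \<otimes> a = a \<otimes> h x"
  shows "type_ring_hom R (extend_hom R h a)"
proof
  show add: "extend_hom R h a (f + g) = extend_hom R h a f \<oplus> extend_hom R h a g" for f g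
    by (induction f g rule: poly_induct2) (simp_all add: hom_add r_distr a_ac)
  have smult: "extend_hom R h a (smult c g) = h c \<otimes> extend_hom R h a g" for c g
  proof (induction g)
    case (pCons d g)
    have "a \<otimes> (h c \<otimes> extend_hom R h a g) = h c \<otimes> (a \<otimes> extend_hom R h a g)"
      using comm by (simp flip: m_assoc)
    then show ?case using pCons by (simp add: hom_mult r_distr)
  qed simp
  show "extend_hom R h a (f * g) = extend_hom R h a f \<otimes> extend_hom R h a g" for f g
    by (induction f) (simp_all add: add smult hom_zero l_distr m_assoc)
qed (simp_all add: hom_one one_pCons)

end

end

lemma (in ring) type_ring_hom_int: "type_ring_hom R (\<lambda>k::int. [k] \<cdot> \<one>)"
proof
  show "[(j + k)] \<cdot> \<one> = [j] \<cdot> \<one> \<oplus> [k] \<cdot> \<one>" for j k :: int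
    by (simp add: add.int_pow_mult)
  show "[(j * k)] \<cdot> \<one> = [j] \<cdot> \<one> \<otimes> [k] \<cdot> \<one>" for j k :: int
    by (simp add: add_pow_ldistr_int add.int_pow_pow mult.commute)
qed simp_all

lemma (in ring) int_multiple_one_commutes:
  "a \<in> carrier R \<Longrightarrow> [(k::int)] \<cdot> \<one> \<otimes> a = a \<otimes> ([k] \<cdot> \<one>)"
  by (simp add: add_pow_ldistr_int add_pow_rdistr_int)

lemma (in ring) int_poly_eval_eq_extend_hom:
  assumes "a \<in> carrier R"
  shows "int_poly_eval R f a = extend_hom R (\<lambda>k. [k] \<cdot> \<one>) a f"
proof (induction f)
  interpret Z: type_ring_hom R "\<lambda>k::int. [k] \<cdot> \<one>" by (rule type_ring_hom_int)
  case 0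
  show ?case using assms by (simp add: int_poly_eval_def Z.hom_zero)
  case (pCons c f)
  show ?case
  proof (cases "f = 0")
    case True
    then show ?thesis using assms by (simp add: int_poly_eval_def)
  next
    case False
    have "int_poly_eval R (pCons c f) a
        = (\<Oplus>i\<in>{..degree f}. [coeff f i] \<cdot> (a [^] Suc i)) \<oplus> [c] \<cdot> \<one>"
      using False assms unfolding int_poly_eval_def degree_pCons_eq[OF False]
      by (subst finsum_Suc2) (simp_all add: Pi_def del: nat_pow_Suc)
    also have "(\<Oplus>i\<in>{..degree f}. [coeff f i] \<cdot> (a [^] Suc i)) = a \<otimes> int_poly_eval R f a"
      unfolding int_poly_eval_def using assms
      by (subst finsum_rdistr) (auto simp: add_pow_rdistr_int simp flip: nat_pow_Suc2 intro!: finsum_cong')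
    finally show ?thesis using pCons assms by (simp add: a_comm)
  qed
qed

lemma (in ring) type_ring_hom_int_poly_eval:
  assumes "a \<in> carrier R"
  shows "type_ring_hom R (\<lambda>f. int_poly_eval R f a)"
  unfolding int_poly_eval_eq_extend_hom[OF assms]
  by (intro type_ring_hom.type_ring_hom_extend_hom type_ring_hom_int int_multiple_one_commutes assms)

lemma (in ring) int_poly_eval_var:
  assumes "a \<in> carrier R"
  shows "int_poly_eval R [:0, 1:] a = a"
  unfolding int_poly_eval_eq_extend_hom[OF assms]
  by (rule type_ring_hom.extend_hom_var[OF type_ring_hom_int assms])

text \<open>
  Three extensions by one variable each. The commutation hypotheses are what the second and third
  extension ask for, since the image of each stage commutes with whatever commutes with its generators.
\<close>
lemma (in ring) commuting_triple_hom:
  assumes closed: "s \<in> carrier R" "t \<in> carrier R" "w \<in> carrier R"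
    and comm: "s \<otimes> t = t \<otimes> s" "s \<otimes> w = w \<otimes> s" "t \<otimes> w = w \<otimes> t"
  obtains h :: "int poly poly poly \<Rightarrow> 'a" and x y z
  where "type_ring_hom R h" "h x = s" "h y = t" "h z = w"
proof -
  define h0 where "h0 = (\<lambda>k::int. [k] \<cdot> \<one>)"
  define h1 where "h1 = extend_hom R h0 s"
  define h2 where "h2 = extend_hom R h1 t"
  interpret h0: type_ring_hom R h0
    unfolding h0_def by (rule type_ring_hom_int)
  have h0_comm: "h0 k \<otimes> a = a \<otimes> h0 k" if "a \<in> carrier R" for k a
    unfolding h0_def using that by (rule int_multiple_one_commutes)
  interpret h1: type_ring_hom R h1
    unfolding h1_def by (intro h0.type_ring_hom_extend_hom h0_comm closed)
  have h1_comm: "h1 f \<otimes> a = a \<otimes> h1 f" if "a \<in> carrier R" "s \<otimes> a = a \<otimes> s" for f a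
    unfolding h1_def using that closed h0_comm by (intro h0.extend_hom_commutes)
  interpret h2: type_ring_hom R h2
    unfolding h2_def by (intro h1.type_ring_hom_extend_hom h1_comm closed comm)
  have h2_comm: "h2 f \<otimes> w = w \<otimes> h2 f" for f
    unfolding h2_def using closed comm h1_comm by (intro h1.extend_hom_commutes)
  show thesis
  proof (rule that)
    show "type_ring_hom R (extend_hom R h2 w)"
      by (intro h2.type_ring_hom_extend_hom h2_comm closed)
    show "extend_hom R h2 w [:[:[:0, 1:]:]:] = s"
      unfolding h2.extend_hom_const[OF closed(3)]
      unfolding h2_def h1.extend_hom_const[OF closed(2)]
      unfolding h1_def h0.extend_hom_var[OF closed(1)] ..
    show "extend_hom R h2 w [:[:0, 1:]:] = t"
      unfolding h2.extend_hom_const[OF closed(3)]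
      unfolding h2_def h1.extend_hom_var[OF closed(2)] ..
    show "extend_hom R h2 w [:0, 1:] = w"
      by (rule h2.extend_hom_var[OF closed(3)])
  qed
qed

section \<open>The characterization\<close>

lemma (in ring) zhou_nil_clean_imp_quintic_nilpotent:
  assumes "zhou_nil_clean R" "a \<in> carrier R"
  shows "nilpotent R (a [^] (5::nat) \<ominus> [(5::int)] \<cdot> (a [^] (3::nat)) \<oplus> [(4::int)] \<cdot> a)"
proof -
  from assms obtain s t w where *: "tripotent R s" "tripotent R t" "nilpotent R w"
      "s \<otimes> t = t \<otimes> s" "s \<otimes> w = w \<otimes> s" "t \<otimes> w = w \<otimes> t" "a = s \<oplus> t \<oplus> w"
    unfolding zhou_nil_clean_def by blast
  then have "s \<in> carrier R" "t \<in> carrier R" "w \<in> carrier R"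
    by (simp_all add: tripotent_def nilpotent_def)
  then obtain h :: "int poly poly poly \<Rightarrow> 'a" and x y z
    where h: "type_ring_hom R h" "h x = s" "h y = t" "h z = w"
    using *(4-6) by (rule commuting_triple_hom)
  interpret h: type_ring_hom R h by fact
  have "quintic (x + y) \<in> {x. h x = \<zero>}"
    using * h by (intro h.kernel.quintic_root_of_tripotents)
      (simp_all add: h.kernel_diff_iff h.hom_power tripotent_def)
  moreover have "(x + y + z) - (x + y) \<in> h.kernel.radical"
    using * h by (simp add: h.radical_kernel_iff)
  ultimately have "quintic (x + y + z) \<in> h.kernel.radical"
    by (rule h.kernel.quintic_radical_of_root)
  moreover have "h (x + y + z) = a" using * h by (simp add: h.hom_add)
  ultimately show ?thesis by (simp add: h.radical_kernel_iff h.hom_quintic)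
qed

text \<open>
  The separating root of the variable in \<open>\<int>[X]\<close>, modulo the kernel of evaluation at \<open>a\<close>. It serves both (3),
  through the value of \<open>f\<close>, and (1), through those of \<open>f - g\<close> and \<open>g\<close>.
\<close>
lemma (in ring) separating_root_of_element:
  assumes nil: "\<And>a. a \<in> carrier R \<Longrightarrow>
      nilpotent R (a [^] (5::nat) \<ominus> [(5::int)] \<cdot> (a [^] (3::nat)) \<oplus> [(4::int)] \<cdot> a)"
    and a: "a \<in> carrier R"
  obtains f g :: "int poly"
  where "int_poly_eval R (quintic f) a = \<zero>"
    "nilpotent R (a \<ominus> int_poly_eval R f a)"
    "tripotent R (int_poly_eval R g a)"
    "tripotent R (int_poly_eval R (f - g) a)"
proof -
  interpret h: type_ring_hom R "\<lambda>f. int_poly_eval R f a"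
    using a by (rule type_ring_hom_int_poly_eval)
  \<comment> \<open>Every element of \<open>\<int>[a]\<close> is covered by the hypothesis, in particular \<open>3\<close> and \<open>a\<close> itself.\<close>
  have quintic_rad: "quintic x \<in> h.kernel.radical" for x
    unfolding h.radical_kernel_iff h.hom_quintic by (intro nil h.hom_closed)
  interpret kernel: idom_ideal "{x. int_poly_eval R x a = \<zero>}" ..
  obtain e t where e: "quintic e \<in> {x. int_poly_eval R x a = \<zero>}" "[:0, 1:] - e \<in> h.kernel.radical"
      "t ^ 3 - t \<in> {x. int_poly_eval R x a = \<zero>}" "(e - t) ^ 3 - (e - t) \<in> {x. int_poly_eval R x a = \<zero>}"
    using kernel.separating_root[OF h.kernel.thirty_mem_radical[OF quintic_rad] quintic_rad] .
  show thesis
  proof (rule that[of e t])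
    show "nilpotent R (a \<ominus> int_poly_eval R e a)"
      using e(2) by (simp add: h.radical_kernel_iff h.hom_diff int_poly_eval_var a)
  qed (use e in \<open>simp_all only: tripotent_def mem_Collect_eq h.kernel_diff_iff h.hom_power h.hom_closed\<close>)
qed

lemma (in ring) quintic_root_iff:
  assumes "e \<in> carrier R"
  shows "e [^] (5::nat) \<ominus> [(5::int)] \<cdot> (e [^] (3::nat)) \<oplus> [(4::int)] \<cdot> e = \<zero>
    \<longleftrightarrow> e [^] (5::nat) = [(5::int)] \<cdot> (e [^] (3::nat)) \<ominus> [(4::int)] \<cdot> e"
proof -
  have "x \<ominus> y \<oplus> z = \<zero> \<longleftrightarrow> x = y \<ominus> z" if "x \<in> carrier R" "y \<in> carrier R" "z \<in> carrier R" for x y z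
  proof -
    have "x \<ominus> y \<oplus> z = x \<ominus> (y \<ominus> z)" using that by (simp add: minus_eq minus_add a_assoc)
    then show ?thesis using that by (simp add: diff_eq_zero_iff)
  qed
  then show ?thesis using assms by simp
qed

theorem theorem2p2:
  fixes R (structure)
  assumes "ring R"
  shows
    "(zhou_nil_clean R \<longleftrightarrow>
        (\<forall>a \<in> carrier R.
           nilpotent R (a [^] (5::nat) \<ominus> [(5::int)] \<cdot> (a [^] (3::nat)) \<oplus> [(4::int)] \<cdot> a)))
     \<and>
     ((\<forall>a \<in> carrier R.
         nilpotent R (a [^] (5::nat) \<ominus> [(5::int)] \<cdot> (a [^] (3::nat)) \<oplus> [(4::int)] \<cdot> a)) \<longleftrightarrow>
        (\<forall>a \<in> carrier R. \<exists>e \<in> int_polys_at R a.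
           nilpotent R (a \<ominus> e) \<and>
           e [^] (5::nat) = [(5::int)] \<cdot> (e [^] (3::nat)) \<ominus> [(4::int)] \<cdot> e))"
    (is "(?clean \<longleftrightarrow> ?nil) \<and> (?nil \<longleftrightarrow> ?root)")
proof -
  interpret ring R by fact
  have "?clean \<Longrightarrow> ?nil" using zhou_nil_clean_imp_quintic_nilpotent by blast
  moreover have ?clean if ?nil
    unfolding zhou_nil_clean_def
  proof
    fix a assume a: "a \<in> carrier R"
    obtain f g where fg: "nilpotent R (a \<ominus> int_poly_eval R f a)"
        "tripotent R (int_poly_eval R g a)" "tripotent R (int_poly_eval R (f - g) a)"
      using separating_root_of_element[of a] \<open>?nil\<close> a by blast
    interpret h: type_ring_hom R "\<lambda>f. int_poly_eval R f a"
      using a by (rule type_ring_hom_int_poly_eval)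
    define s t w where stw: "s = f - g" "t = g" "w = [:0, 1:] - f"
    have commute: "int_poly_eval R u a \<otimes> int_poly_eval R v a
        = int_poly_eval R v a \<otimes> int_poly_eval R u a" for u v
      by (metis h.hom_mult mult.commute)
    have w: "int_poly_eval R w a = a \<ominus> int_poly_eval R f a"
      using a by (simp add: stw h.hom_diff int_poly_eval_var)
    have "int_poly_eval R (s + t + w) a = a"
      using a by (simp add: stw int_poly_eval_var)
    then have "a = int_poly_eval R s a \<oplus> int_poly_eval R t a \<oplus> int_poly_eval R w a"
      by (simp add: h.hom_add)
    moreover have "tripotent R (int_poly_eval R s a)" "tripotent R (int_poly_eval R t a)"
      "nilpotent R (int_poly_eval R w a)"
      unfolding w using fg by (simp_all add: stw)
    ultimately show "\<exists>s t w. tripotent R s \<and> tripotent R t \<and> nilpotent R w \<and>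
        s \<otimes> t = t \<otimes> s \<and> s \<otimes> w = w \<otimes> s \<and> t \<otimes> w = w \<otimes> t \<and> a = s \<oplus> t \<oplus> w"
      using commute by blast
  qed
  moreover have ?root if ?nil
  proof
    fix a assume a: "a \<in> carrier R"
    obtain f g where f: "int_poly_eval R (quintic f) a = \<zero>" "nilpotent R (a \<ominus> int_poly_eval R f a)"
      using separating_root_of_element[of a] \<open>?nil\<close> a by blast
    interpret h: type_ring_hom R "\<lambda>f. int_poly_eval R f a"
      using a by (rule type_ring_hom_int_poly_eval)
    show "\<exists>e \<in> int_polys_at R a. nilpotent R (a \<ominus> e) \<and>
        e [^] (5::nat) = [(5::int)] \<cdot> (e [^] (3::nat)) \<ominus> [(4::int)] \<cdot> e"
      using f quintic_root_iff[OF h.hom_closed]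
      by (intro bexI[of _ "int_poly_eval R f a"]) (auto simp: h.hom_quintic int_polys_at_def)
  qed
  moreover have ?nil if ?root
  proof
    fix a assume a: "a \<in> carrier R"
    interpret h: type_ring_hom R "\<lambda>f. int_poly_eval R f a"
      using a by (rule type_ring_hom_int_poly_eval)
    obtain f where f: "nilpotent R (a \<ominus> int_poly_eval R f a)"
      "int_poly_eval R f a [^] (5::nat)
        = [(5::int)] \<cdot> (int_poly_eval R f a [^] (3::nat)) \<ominus> [(4::int)] \<cdot> int_poly_eval R f a"
      using \<open>?root\<close> a by (auto simp: int_polys_at_def)
    have "quintic f \<in> {x. int_poly_eval R x a = \<zero>}"
      using iffD2[OF quintic_root_iff[OF h.hom_closed] f(2)]
      by (simp only: mem_Collect_eq h.hom_quintic)
    moreover have "[:0, 1:] - f \<in> h.kernel.radical"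
      using f(1) a by (simp add: h.radical_kernel_iff h.hom_diff int_poly_eval_var)
    ultimately have "quintic [:0, 1:] \<in> h.kernel.radical"
      by (rule h.kernel.quintic_radical_of_root)
    then show "nilpotent R (a [^] (5::nat) \<ominus> [(5::int)] \<cdot> (a [^] (3::nat)) \<oplus> [(4::int)] \<cdot> a)"
      using a by (simp add: h.radical_kernel_iff h.hom_quintic int_poly_eval_var)
  qed
  ultimately show ?thesis by blast
qed

end
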